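(* The set of similarity dimensions for $(n,a,b)$-Ammann Chair Fractals is dense in $[0,2]$.
   Context: Here $(n,a,b)$ ranges over all $n\in\mathbf N$, $a\in\mathbf N\cap[0,F_{n-1}]$ and $b\in\mathbf N\cap[0,F_n]$, except the case in which all tiles are taken ($a=F_{n-1}$ and $b=F_n$); the values $a=0$ and $b=0$ are allowed. Also $\phi=\frac{1+\sqrt5}{2}$, and $F_m$ is the $m$-th Fibonacci number, with $F_0=0$, $F_1=1$, $F_{m+2}=F_{m+1}+F_m$. Ammann Chair tiling. There are two tile types, small ($S$) and big ($B$); they are similar, and the big tile is larger than the small tile by the linear factor $\phi^{1/2}$. One substitution step replaces a small tile by one big tile ($S\to B$) and a big tile by one small and one big tile ($B\to S+B$), with linear inflation factor $\phi^{1/2}$ (equivalently, the new tiles are scaled down by $\phi^{-1/2}$, so that the region covered is unchanged). Gen $n$ is the result of $n$ steps starting from a single small tile. It consists of $F_{n-1}$ small tiles and $F_n$ big tiles. Performing $n$ steps at once is called the $n$-substitution; its inflation factor is $r=\phi^{n/2}$. It replaces a small tile by a copy of Gen $n$ and a big tile by a copy of Gen $n+1$. $(n,a,b)$-Ammann Chair Fractal. Choose $a$ small tiles and $b$ big tiles of Gen $n$ to be removed. The region covered by the chosen tiles is removed at every iteration of the $n$-substitution. The resulting limiting self-similar set is an $(n,a,b)$-Ammann Chair Fractal. Similarity dimension. The part of the fractal in a small tile, scaled by $r=\phi^{n/2}$, consists of $F_{n-1}-a$ copies of the part in a small tile and $F_n-b$ copies of the part in a big tile, where a big-tile part is a small-tile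 part scaled by $\phi^{1/2}$ and therefore counts as $(\phi^{1/2})^d$ small-tile copies in dimension $d$. The similarity dimension $d=d(n,a,b)\ge 0$ of an $(n,a,b)$-Ammann Chair Fractal is determined by $$\left(\phi^{n/2}\right)^d=(F_{n-1}-a)+\phi^{d/2}(F_n-b),$$ that is, $d(n,a,b)=2\log_\phi x$, where $x$ is the unique positive real root of $x^n-(F_n-b)x-(F_{n-1}-a)$. *)

theory Defs
  imports "HOL-Analysis.Analysis" "HOL-Number_Theory.Fib"
begin

definition golden :: real where
  "golden = (1 + sqrt 5) / 2"

text \<open>
  The linear factor \<open>\<phi>\<^sup>-\<^sup>1\<^sup>/\<^sup>2\<close> of one substitution step; it satisfies \<open>s\<^sup>2 + s\<^sup>4 = 1\<close>.
\<close>

definition shrink :: real where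
  "shrink = 1 / sqrt golden"

text \<open>
  The Ammann chair is an L-shaped hexagon with side lengths \<open>1, s, s\<^sup>2, s\<^sup>3, s\<^sup>4, s\<^sup>5\<close>.  It splits
  into a copy scaled by \<open>s\<close> and a copy scaled by \<open>s\<^sup>2\<close> (lemma \<open>chair_split\<close>).
\<close>

definition chair :: "complex set" where
  "chair = {z. 0 \<le> Re z \<and> 0 \<le> Im z \<and>
     ((Re z \<le> shrink \<and> Im z \<le> shrink ^ 2) \<or> (Re z \<le> shrink ^ 3 \<and> Im z \<le> 1))}"

datatype kind = Small | Big

fun subtile :: "kind \<Rightarrow> complex \<Rightarrow> complex" where
  "subtile Big z = of_real shrink * (1 + \<i> * z)"
| "subtile Small z = \<i> + of_real (shrink ^ 2) * cnj z"

text \<open>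
  A tile is given by its kind and by its address, which records for each splitting
  \<open>B \<rightarrow> S + B\<close> met on the way down which of the two parts was entered.  A step \<open>S \<rightarrow> B\<close> leaves the
  region unchanged and only renames the tile, so it does not appear in the address.
\<close>

type_synonym tile = "kind \<times> kind list"

fun place :: "kind list \<Rightarrow> complex \<Rightarrow> complex" where
  "place [] z = z"
| "place (k # w) z = subtile k (place w z)"

fun substitute :: "tile \<Rightarrow> tile set" where
  "substitute (Small, w) = {(Big, w)}"
| "substitute (Big, w) = {(Small, w @ [Small]), (Big, w @ [Big])}"

primrec gen :: "nat \<Rightarrow> tile set" where
  "gen 0 = {(Small, [])}"
| "gen (Suc n) = (\<Union>t\<in>gen n. substitute t)"

text \<open>
  The stages start from one small tile occupying \<open>chair\<close>.  In every iteration each region is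
  replaced by its copies in the tiles of Gen \<open>n\<close> that are not in the removed set \<open>R\<close>.  Each
  such tile, small or big, is the image of \<open>chair\<close> under \<open>place w\<close>, so the part of the fractal in
  a big tile is a scaled copy of the part in a small tile.
\<close>

primrec stage :: "nat \<Rightarrow> tile set \<Rightarrow> nat \<Rightarrow> complex set" where
  "stage n R 0 = chair"
| "stage n R (Suc k) = (\<Union>(_, w)\<in>gen n - R. place w ` stage n R k)"

definition ammann_chair_fractal :: "nat \<Rightarrow> nat \<Rightarrow> nat \<Rightarrow> complex set \<Rightarrow> bool" where
  "ammann_chair_fractal n a b K \<longleftrightarrow>
     (\<exists>R. R \<subset> gen n \<and> card {t \<in> R. fst t = Small} = a \<and> card {t \<in> R. fst t = Big} = b \<and>
          K = (\<Inter>k. stage n R k))"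

definition dimension_equation :: "nat \<Rightarrow> nat \<Rightarrow> nat \<Rightarrow> real \<Rightarrow> bool" where
  "dimension_equation n a b d \<longleftrightarrow>
     (golden powr (real n / 2)) powr d =
       (real (fib (n - 1)) - real a) + golden powr (d / 2) * (real (fib n) - real b)"

text \<open>
  The similarity dimension has to be determined by the equation.  Uniqueness is part of the
  definition because for \<open>(n, a, b) = (1, 0, 0)\<close> every \<open>d\<close> solves the equation, so
  that this triple has no similarity dimension.
\<close>

definition similarity_dimension :: "nat \<Rightarrow> nat \<Rightarrow> nat \<Rightarrow> real \<Rightarrow> bool" where
  "similarity_dimension n a b d \<longleftrightarrow>
     0 \<le> d \<and> dimension_equation n a b d \<and>
     (\<forall>d'. 0 \<le> d' \<and> dimension_equation n a b d' \<longrightarrow> d' = d)"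

definition ammann_chair_dimensions :: "real set" where
  "ammann_chair_dimensions =
     {d. \<exists>n a b K. 1 \<le> n \<and> a \<le> fib (n - 1) \<and> b \<le> fib n \<and>
         \<not> (a = fib (n - 1) \<and> b = fib n) \<and>
         ammann_chair_fractal n a b K \<and> similarity_dimension n a b d}"

lemma golden_gt_1: "golden > 1"
  unfolding golden_def using real_less_rsqrt[of 1 5] by simp

lemma golden_sq: "golden ^ 2 = golden + 1"
  unfolding golden_def by (simp add: power2_eq_square field_simps)

lemma shrink_pos: "0 < shrink"
  unfolding shrink_def using golden_gt_1 by simp

lemma shrink_sq: "shrink ^ 2 = 1 / golden"
  unfolding shrink_def using golden_gt_1 by (simp add: power_divide)

lemma shrink_eq: "shrink ^ 2 + shrink ^ 4 = 1"
proof -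
  have "shrink ^ 4 = (shrink ^ 2) ^ 2"
    by (simp flip: power_mult)
  also have "\<dots> = 1 / golden ^ 2"
    by (simp add: shrink_sq power_divide)
  also have "\<dots> = 1 - 1 / golden"
    using golden_gt_1 golden_sq by (simp add: divide_simps) (simp add: algebra_simps power2_eq_square)
  finally show ?thesis
    by (simp add: shrink_sq)
qed

lemma Re_subtile: "Re (subtile Big z) = shrink * (1 - Im z)" "Re (subtile Small z) = shrink ^ 2 * Re z"
  by simp_all

lemma Im_subtile: "Im (subtile Big z) = shrink * Re z" "Im (subtile Small z) = 1 - shrink ^ 2 * Im z"
  by (simp_all flip: of_real_power)

lemma dist_subtile:
  "dist (subtile k x) (subtile k y) = (if k = Small then shrink ^ 2 else shrink) * dist x y"
proof (cases k)
  case Small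
  have "subtile k x - subtile k y = of_real (shrink ^ 2) * cnj (x - y)"
    using Small by (simp add: algebra_simps)
  then show ?thesis
    using Small by (simp add: dist_norm norm_mult norm_power del: complex_cnj_diff)
next
  case Big
  have "subtile k x - subtile k y = of_real shrink * (\<i> * (x - y))"
    using Big by (simp add: algebra_simps)
  then show ?thesis
    using Big shrink_pos by (simp add: dist_norm norm_mult)
qed

lemma subtile_Big_chair:
  "z \<in> subtile Big ` chair \<longleftrightarrow>
     0 \<le> Im z \<and> Re z \<le> shrink \<and>
     ((Im z \<le> shrink ^ 2 \<and> shrink ^ 5 \<le> Re z) \<or> (Im z \<le> shrink ^ 4 \<and> 0 \<le> Re z))"
proof -
  have eq: "1 - shrink ^ 2 = shrink ^ 4" using shrink_eq by simp
  let ?w = "Complex (Im z / shrink) (1 - Re z / shrink)"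
  have inv: "subtile Big ?w = z"
    using shrink_pos by (simp add: complex_eq_iff field_simps)
  have inj: "w = ?w" if "z = subtile Big w" for w
    using shrink_pos that by (simp add: complex_eq_iff field_simps)
  have "z \<in> subtile Big ` chair \<longleftrightarrow> ?w \<in> chair"
    using inv inj by (metis image_iff)
  moreover have "Im ?w \<le> shrink ^ 2 \<longleftrightarrow> shrink ^ 5 \<le> Re z"
  proof -
    have "Im ?w \<le> shrink ^ 2 \<longleftrightarrow> shrink ^ 4 \<le> Re z / shrink" using eq by auto
    then show ?thesis using shrink_pos by (simp add: pos_le_divide_eq flip: power_Suc2)
  qed
  moreover have "Re ?w \<le> shrink \<longleftrightarrow> Im z \<le> shrink ^ 2"
    using shrink_pos by (simp add: pos_divide_le_eq power2_eq_square)
  moreover have "Re ?w \<le> shrink ^ 3 \<longleftrightarrow> Im z \<le> shrink ^ 4"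
    using shrink_pos by (simp add: pos_divide_le_eq flip: power_Suc2)
  moreover have "0 \<le> Re ?w \<longleftrightarrow> 0 \<le> Im z" "0 \<le> Im ?w \<longleftrightarrow> Re z \<le> shrink"
    "Im ?w \<le> 1 \<longleftrightarrow> 0 \<le> Re z"
    using shrink_pos by (auto simp: zero_le_divide_iff divide_le_eq_1)
  ultimately show ?thesis
    unfolding chair_def mem_Collect_eq by blast
qed

lemma subtile_Small_chair:
  "z \<in> subtile Small ` chair \<longleftrightarrow>
     0 \<le> Re z \<and> Im z \<le> 1 \<and>
     ((Re z \<le> shrink ^ 3 \<and> shrink ^ 2 \<le> Im z) \<or> (Re z \<le> shrink ^ 5 \<and> shrink ^ 4 \<le> Im z))"
proof -
  have eq: "1 - shrink ^ 2 = shrink ^ 4" "1 - shrink ^ 4 = shrink ^ 2"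
    using shrink_eq by simp_all
  have pos: "0 < shrink ^ 2" using shrink_pos by simp
  let ?w = "Complex (Re z / shrink ^ 2) ((1 - Im z) / shrink ^ 2)"
  have inv: "subtile Small ?w = z"
    using pos by (simp add: complex_eq_iff Re_subtile Im_subtile del: subtile.simps)
  have inj: "w = ?w" if "z = subtile Small w" for w
    using pos that by (simp add: complex_eq_iff Re_subtile Im_subtile del: subtile.simps)
  have "z \<in> subtile Small ` chair \<longleftrightarrow> ?w \<in> chair"
    using inv inj by (metis image_iff)
  moreover have "Re ?w \<le> shrink \<longleftrightarrow> Re z \<le> shrink ^ 3"
    using pos by (simp add: pos_divide_le_eq eval_nat_numeral)
  moreover have "Re ?w \<le> shrink ^ 3 \<longleftrightarrow> Re z \<le> shrink ^ 5"
    using pos by (simp add: pos_divide_le_eq flip: power_add)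
  moreover have "Im ?w \<le> shrink ^ 2 \<longleftrightarrow> shrink ^ 2 \<le> Im z"
  proof -
    have "Im ?w \<le> shrink ^ 2 \<longleftrightarrow> 1 - Im z \<le> shrink ^ 4"
      using pos by (simp add: pos_divide_le_eq flip: power_add)
    then show ?thesis using eq by linarith
  qed
  moreover have "Im ?w \<le> 1 \<longleftrightarrow> shrink ^ 4 \<le> Im z"
  proof -
    have "Im ?w \<le> 1 \<longleftrightarrow> 1 - Im z \<le> shrink ^ 2"
      using pos by (simp add: pos_divide_le_eq)
    then show ?thesis using eq by linarith
  qed
  moreover have "0 \<le> Re ?w \<longleftrightarrow> 0 \<le> Re z" "0 \<le> Im ?w \<longleftrightarrow> Im z \<le> 1"
    using pos by (simp_all add: zero_le_divide_iff)
  ultimately show ?thesis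
    unfolding chair_def mem_Collect_eq by blast
qed

lemma chair_split: "chair = subtile Small ` chair \<union> subtile Big ` chair"
proof -
  have "shrink \<le> 1"
    unfolding shrink_def using golden_gt_1 by simp
  then have "0 < shrink ^ 5" "shrink ^ 5 \<le> shrink ^ 3" "shrink ^ 3 \<le> shrink"
    "0 < shrink ^ 4" "shrink ^ 4 \<le> shrink ^ 2" "shrink ^ 2 \<le> 1"
    using shrink_pos power_decreasing[of 3 5 shrink] power_decreasing[of 2 4 shrink]
      power_decreasing[of 1 3 shrink] power_decreasing[of 0 2 shrink] by auto
  then show ?thesis
    unfolding set_eq_iff Un_iff subtile_Big_chair subtile_Small_chair
    unfolding chair_def mem_Collect_eq by (smt (verit))
qed

text \<open>A small tile of Gen \<open>n\<close> has scale \<open>s\<^sup>n\<close>, a big one has scale \<open>s\<^sup>n\<^sup>-\<^sup>1\<close>.\<close>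

lemma place_append: "place (v @ w) z = place v (place w z)"
  by (induction v) auto

lemma dist_place_gen:
  "(k, w) \<in> gen n \<Longrightarrow>
     dist (place w x) (place w y) * (if k = Small then 1 else shrink) = shrink ^ n * dist x y"
proof (induction n arbitrary: k w x y)
  case 0
  then show ?case by simp
next
  case (Suc n)
  from Suc.prems obtain k' w' where t: "(k', w') \<in> gen n" "(k, w) \<in> substitute (k', w')"
    by auto
  show ?case
  proof (cases k')
    case Small
    then show ?thesis using t Suc.IH[OF t(1), of x y] by (simp add: mult_ac)
  next
    case Big
    from t(2) Big consider "k = Small" "w = w' @ [Small]" | "k = Big" "w = w' @ [Big]"
      by auto
    then show ?thesis
    proof cases
      case 1
      then show ?thesis
        using Suc.IH[OF t(1), of "subtile Small x" "subtile Small y"] Big shrink_pos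
        by (simp add: place_append dist_subtile power2_eq_square mult_ac del: subtile.simps)
    next
      case 2
      then show ?thesis
        using Suc.IH[OF t(1), of "subtile Big x" "subtile Big y"] Big shrink_pos
        by (simp add: place_append dist_subtile mult_ac del: subtile.simps)
    qed
  qed
qed

lemma finite_gen: "finite (gen n)"
proof (induction n)
  case (Suc n)
  have "finite (substitute t)" for t
    by (cases t rule: substitute.cases) auto
  then show ?case using Suc by simp
qed simp

lemma gen_Small_last: "(Small, w) \<in> gen n \<Longrightarrow> w = [] \<or> last w = Small"
proof (cases n)
  case (Suc m)
  assume "(Small, w) \<in> gen n"
  then obtain k v where "(Small, w) \<in> substitute (k, v)" using Suc by auto
  then show ?thesis by (cases k) auto
qed simp

lemma card_gen_aux:
  "card {w. (Small, w) \<in> gen n} = (if n = 0 then 1 else fib (n - 1)) \<and>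
   card {w. (Big, w) \<in> gen n} = fib n"
proof (induction n)
  case 0
  then show ?case by simp
next
  case (Suc n)
  let ?A = "\<lambda>n. {w. (Small, w) \<in> gen n}" and ?B = "\<lambda>n. {w. (Big, w) \<in> gen n}"
  have memS: "(Small, w) \<in> substitute (k, v) \<longleftrightarrow> k = Big \<and> w = v @ [Small]"
    and memB: "(Big, w) \<in> substitute (k, v) \<longleftrightarrow>
                 (k = Small \<and> w = v) \<or> (k = Big \<and> w = v @ [Big])" for w k v
    by (cases k; auto)+
  have memG: "t \<in> gen (Suc n) \<longleftrightarrow> (\<exists>k v. (k, v) \<in> gen n \<and> t \<in> substitute (k, v))" for t
    by (simp add: Bex_def split_paired_Ex)
  have A: "?A (Suc n) = (\<lambda>w. w @ [Small]) ` ?B n"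
    unfolding memG by (auto simp: memS)
  have B: "?B (Suc n) = ?A n \<union> (\<lambda>w. w @ [Big]) ` ?B n"
    unfolding memG by (auto simp: memB)
  have "?A n \<subseteq> snd ` gen n" "?B n \<subseteq> snd ` gen n"
    by force+
  then have fin: "finite (?A n)" "finite (?B n)"
    using finite_gen[of n] by (meson finite_imageI finite_subset)+
  have disj: "?A n \<inter> (\<lambda>w. w @ [Big]) ` ?B n = {}"
    using gen_Small_last by fastforce
  have cA: "card (?A (Suc n)) = card (?B n)"
    unfolding A by (intro card_image) (auto simp: inj_on_def)
  have "card (?B (Suc n)) = card (?A n) + card ((\<lambda>w. w @ [Big]) ` ?B n)"
    unfolding B using fin disj by (intro card_Un_disjoint) auto
  also have "card ((\<lambda>w. w @ [Big]) ` ?B n) = card (?B n)"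
    by (intro card_image) (auto simp: inj_on_def)
  finally have cB: "card (?B (Suc n)) = card (?A n) + card (?B n)" .
  show ?case
  proof (cases n)
    case 0
    then show ?thesis using Suc.IH cA cB by simp
  next
    case (Suc m)
    then show ?thesis using Suc.IH cA cB by simp
  qed
qed

lemma card_gen:
  assumes "1 \<le> n"
  shows "card {t \<in> gen n. fst t = Small} = fib (n - 1)" "card {t \<in> gen n. fst t = Big} = fib n"
proof -
  have eq: "{t \<in> gen n. fst t = k} = Pair k ` {w. (k, w) \<in> gen n}" for k
    by force
  have "card {t \<in> gen n. fst t = k} = card {w. (k, w) \<in> gen n}" for k
    unfolding eq by (intro card_image) (auto simp: inj_on_def)
  then show "card {t \<in> gen n. fst t = Small} = fib (n - 1)"
    "card {t \<in> gen n. fst t = Big} = fib n"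
    using card_gen_aux[of n] assms by simp_all
qed

lemma ammann_chair_fractal_exists_iff:
  assumes "1 \<le> n"
  shows "(\<exists>K. ammann_chair_fractal n a b K) \<longleftrightarrow>
           a \<le> fib (n - 1) \<and> b \<le> fib n \<and> \<not> (a = fib (n - 1) \<and> b = fib n)"
proof -
  define A where "A = {t \<in> gen n. fst t = Small}"
  define B where "B = {t \<in> gen n. fst t = Big}"
  have fin: "finite A" "finite B"
    unfolding A_def B_def using finite_gen by simp_all
  have card: "card A = fib (n - 1)" "card B = fib n"
    unfolding A_def B_def using card_gen[OF assms] by simp_all
  have gen: "gen n = A \<union> B"
    unfolding A_def B_def using kind.exhaust by blast
  show ?thesis
  proof
    assume "\<exists>K. ammann_chair_fractal n a b K"
    then obtain R where R: "R \<subset> gen n" "card {t \<in> R. fst t = Small} = a"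
        "card {t \<in> R. fst t = Big} = b"
      unfolding ammann_chair_fractal_def by blast
    let ?S = "{t \<in> R. fst t = Small}" and ?T = "{t \<in> R. fst t = Big}"
    have sub: "?S \<subseteq> A" "?T \<subseteq> B"
      using R(1) unfolding A_def B_def by auto
    have "R = ?S \<union> ?T" using kind.exhaust by blast
    then have "\<not> (?S = A \<and> ?T = B)" using R(1) gen by auto
    then have "card ?S \<noteq> card A \<or> card ?T \<noteq> card B"
      using card_subset_eq[OF fin(1) sub(1)] card_subset_eq[OF fin(2) sub(2)] by blast
    moreover have "card ?S \<le> card A" "card ?T \<le> card B"
      using card_mono[OF fin(1) sub(1)] card_mono[OF fin(2) sub(2)] .
    ultimately show "a \<le> fib (n - 1) \<and> b \<le> fib n \<and> \<not> (a = fib (n - 1) \<and> b = fib n)"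
      unfolding R(2,3) card by blast
  next
    assume ab: "a \<le> fib (n - 1) \<and> b \<le> fib n \<and> \<not> (a = fib (n - 1) \<and> b = fib n)"
    obtain S where S: "S \<subseteq> A" "card S = a"
      using ab card obtain_subset_with_card_n[of a A] by auto
    obtain T where T: "T \<subseteq> B" "card T = b"
      using ab card obtain_subset_with_card_n[of b B] by auto
    have "{t \<in> S \<union> T. fst t = Small} = S" "{t \<in> S \<union> T. fst t = Big} = T"
      using S T unfolding A_def B_def by auto
    moreover have "S \<union> T \<subset> gen n"
    proof -
      have "S \<union> T \<noteq> gen n"
      proof
        assume "S \<union> T = gen n"
        then have "S = A" "T = B"
          using S T unfolding A_def B_def by auto
        then show False using S T card ab by simp
      qed
      then show ?thesis using S T gen by blast
    qed
    ultimately have "ammann_chair_fractal n a b (\<Inter>k. stage n (S \<union> T) k)"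
      unfolding ammann_chair_fractal_def using S(2) T(2) by (intro exI[of _ "S \<union> T"] conjI) simp_all
    then show "\<exists>K. ammann_chair_fractal n a b K" ..
  qed
qed

end

(* Put x = golden powr (d / 2) and write A, B for the numbers of small and big tiles that are kept,
   so that x ^ n = A + B x.  Since golden ^ n = F_(n-1) + F_n golden, a root x > golden would exceed
   the bound F_(n-1) + F_n x as soon as n >= 2; for n = 1 the equation does not determine d.  Hence
   d <= 2.  For density it is enough to remove all small tiles: then
   d = 2 log B / (n - 1) to base golden, and the integer
   B = ceiling (golden powr ((n - 1) c / 2) / golden) <= F_n brings d within 2 / (n - 1) of any
   given c in [0, 2]. *)

theory Submission
  imports Defs
begin

text \<open>With no tile removed, the dimension equation has the solution \<open>d = 2\<close>, and
  this is that instance. The relation \<open>golden_sq\<close> carries it along the Fibonacci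
  recurrence.\<close>

lemma golden_power: "1 \<le> n \<Longrightarrow> golden ^ n = real (fib (n - 1)) + golden * real (fib n)"
proof (induction n rule: nat_induct_at_least)
  case base
  show ?case by simp
next
  case (Suc n)
  then obtain m where m: "n = Suc m"
    by (cases n) auto
  have "golden ^ Suc n = golden * real (fib (n - 1)) + golden ^ 2 * real (fib n)"
    using Suc.IH by (simp add: algebra_simps power2_eq_square)
  also have "\<dots> = real (fib n) + golden * (real (fib (n - 1)) + real (fib n))"
    by (simp add: golden_sq algebra_simps)
  finally show ?case by (simp add: m)
qed

text \<open>Both sides obey the Fibonacci recurrence, so two initial cases suffice; the second
  amounts to \<open>golden\<close> \<le> 2. It later ensures that enough big tiles are
  available.\<close>

lemma golden_power_le_fib: "golden ^ n \<le> real (fib (n + 2))"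
proof (induction n rule: fib.induct)
  case 1
  show ?case by simp
next
  case 2
  have "sqrt 5 \<le> 3" by (rule real_le_lsqrt) auto
  then show ?case by (simp add: golden_def eval_nat_numeral)
next
  case (3 n)
  have "golden ^ Suc (Suc n) = golden ^ n * golden ^ 2"
    by (simp add: power2_eq_square)
  also have "\<dots> = golden ^ Suc n + golden ^ n"
    by (simp add: golden_sq algebra_simps)
  finally show ?case using 3 by simp
qed

text \<open>Exchanging the exponents \<open>n / 2\<close> and \<open>d\<close> makes the equation
  polynomial in \<open>golden powr (d / 2)\<close>.\<close>

lemma dimension_equation_iff:
  "dimension_equation n a b d \<longleftrightarrow>
     (golden powr (d / 2)) ^ n =
       (real (fib (n - 1)) - real a) + golden powr (d / 2) * (real (fib n) - real b)"
proof -
  have "(golden powr (real n / 2)) powr d = (golden powr (d / 2)) ^ n"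
    using golden_gt_1 by (simp add: powr_powr mult.commute flip: powr_realpow)
  then show ?thesis by (simp add: dimension_equation_def)
qed

lemma dimension_equation_le_2:
  assumes n: "2 \<le> n" and eq: "dimension_equation n a b d"
  shows "d \<le> 2"
proof (rule ccontr)
  assume "\<not> d \<le> 2"
  \<comment> \<open>The factor by which the root exceeds \<open>golden\<close>.\<close>
  define t where "t = golden powr (d / 2 - 1)"
  have t: "1 < t"
    using \<open>\<not> d \<le> 2\<close> golden_gt_1 by (simp add: t_def)
  have x: "golden powr (d / 2) = golden * t"
    using golden_gt_1 by (simp add: t_def powr_diff)
  have "golden ^ n * t ^ n = (golden * t) ^ n"
    by (simp add: power_mult_distrib)
  also have "\<dots> \<le> real (fib (n - 1)) + golden * t * real (fib n)"
    using eq golden_gt_1 t unfolding dimension_equation_iff x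
    by (simp only:, intro add_mono mult_left_mono) auto
  \<comment> \<open>Enlarging the constant term by \<open>t\<close> too lets
    \<open>golden ^ n\<close> factor out and cancel.\<close>
  also have "\<dots> \<le> t * real (fib (n - 1)) + golden * t * real (fib n)"
    using t mult_right_mono[of 1 t "real (fib (n - 1))"] by simp
  also have "\<dots> = golden ^ n * t"
    using golden_power[of n] n by (simp add: algebra_simps)
  finally have "t ^ n \<le> t ^ 1"
    using golden_gt_1 by simp
  then show False
    using t n by (simp only: power_increasing_iff)
qed

lemma ammann_chair_dimensions_le_2:
  assumes "d \<in> ammann_chair_dimensions"
  shows "d \<le> 2"
proof -
  obtain n a b where nab: "1 \<le> n" "a \<le> fib (n - 1)" "b \<le> fib n"
      "\<not> (a = fib (n - 1) \<and> b = fib n)" and d: "similarity_dimension n a b d"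
    using assms unfolding ammann_chair_dimensions_def by blast
  \<comment> \<open>For \<open>n = 1\<close>, \<open>fib 0 = 0\<close> and \<open>fib 1 = 1\<close>
    force \<open>a = b = 0\<close>, and the equation becomes \<open>x = x\<close>.\<close>
  have "n \<noteq> 1"
  proof
    assume "n = 1"
    then have "dimension_equation n a b d'" for d'
      using nab by (simp add: dimension_equation_iff)
    then have "d' = d" if "0 \<le> d'" for d'
      using d that unfolding similarity_dimension_def by blast
    from this[of 0] this[of 1] show False by simp
  qed
  then show ?thesis
    using nab d dimension_equation_le_2[of n a b d] unfolding similarity_dimension_def by simp
qed

text \<open>Without small tiles the constant term vanishes: \<open>x ^ (m + 1) = B * x\<close>, and
  one positive factor \<open>x\<close> cancels. Here \<open>B\<close> counts the big tiles kept,
  hence the removed number \<open>fib (m + 1) - B\<close>.\<close>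

lemma dimension_equation_no_small_iff:
  assumes m: "1 \<le> m" and B: "1 \<le> B" "B \<le> fib (m + 1)"
  shows "dimension_equation (m + 1) (fib m) (fib (m + 1) - B) d \<longleftrightarrow>
           d = 2 * log golden (real B) / real m"
proof -
  have "dimension_equation (m + 1) (fib m) (fib (m + 1) - B) d \<longleftrightarrow>
          (golden powr (d / 2)) ^ m = real B"
    using golden_gt_1 B(2) by (simp add: dimension_equation_iff of_nat_diff)
  also have "(golden powr (d / 2)) ^ m = golden powr (real m * d / 2)"
    using golden_gt_1 by (simp add: powr_powr mult.commute flip: powr_realpow)
  also have "golden powr (real m * d / 2) = real B \<longleftrightarrow> log golden (real B) = real m * d / 2"
    using golden_gt_1 B(1) by (intro powr_eq_iff) auto
  also have "\<dots> \<longleftrightarrow> d = 2 * log golden (real B) / real m"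
    using m by (auto simp: field_simps)
  finally show ?thesis .
qed

lemma log_in_ammann_chair_dimensions:
  assumes "1 \<le> m" "1 \<le> B" "B \<le> fib (m + 1)"
  shows "2 * log golden (real B) / real m \<in> ammann_chair_dimensions"
proof -
  let ?d = "2 * log golden (real B) / real m"
  have "0 \<le> ?d"
    using assms golden_gt_1 by simp
  then have sim: "similarity_dimension (m + 1) (fib m) (fib (m + 1) - B) ?d"
    unfolding similarity_dimension_def dimension_equation_no_small_iff[OF assms] by blast
  \<comment> \<open>Since \<open>B\<close> \<ge> 1, at least one big tile survives.\<close>
  have ok: "\<not> (fib m = fib (m + 1 - 1) \<and> fib (m + 1) - B = fib (m + 1))"
    using assms by simp
  moreover obtain K where "ammann_chair_fractal (m + 1) (fib m) (fib (m + 1) - B) K"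
    using ok ammann_chair_fractal_exists_iff[of "m + 1" "fib m" "fib (m + 1) - B"] by auto
  ultimately show ?thesis
    using sim unfolding ammann_chair_dimensions_def
    by (intro CollectI exI[of _ "m + 1"] exI[of _ "fib m"] exI[of _ "fib (m + 1) - B"] exI[of _ K])
       simp
qed

lemma ammann_chair_dimensions_approx:
  assumes m: "1 \<le> m" and c: "0 \<le> c" "c \<le> 2"
  shows "\<exists>d\<in>ammann_chair_dimensions. \<bar>d - c\<bar> \<le> 2 / real m"
proof -
  define y where "y = golden powr (real m * c / 2)"
  \<comment> \<open>Keeping exactly \<open>y\<close> big tiles would give dimension
    \<open>c\<close>. Dividing by \<open>golden\<close> before rounding up keeps the count at most
    \<open>fib (m + 1)\<close>, even for \<open>c = 2\<close>.\<close>
  define B where "B = nat \<lceil>y / golden\<rceil>"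
  have y: "1 \<le> y"
    using golden_gt_1 m c by (simp add: y_def ge_one_powr_ge_zero)
  have pos: "0 < y / golden"
    using y golden_gt_1 by simp
  have B: "real B = of_int \<lceil>y / golden\<rceil>"
    using pos by (simp add: B_def)
  have B_ge: "y / golden \<le> real B" and B_less: "real B < y / golden + 1"
    unfolding B by linarith+
  have B_pos: "1 \<le> B"
    using pos B_ge by (cases B) auto
  have "y \<le> golden powr real m"
    using golden_gt_1 m c unfolding y_def by (intro powr_mono) (auto simp: field_simps)
  also have "\<dots> = golden ^ (m - 1) * golden"
    using m golden_gt_1 by (simp add: powr_realpow flip: power_Suc2)
  finally have "y / golden \<le> golden ^ (m - 1)"
    using golden_gt_1 by (simp add: field_simps)
  also have "\<dots> \<le> real (fib (m + 1))"
    using golden_power_le_fib[of "m - 1"] m by simp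
  finally have B_le: "B \<le> fib (m + 1)"
    by (simp add: B_def ceiling_le_iff nat_le_iff)
  \<comment> \<open>The rounding error is below 1 \<le> \<open>y\<close>, and
    \<open>1 / golden + 1 = golden\<close>; so \<open>B\<close> differs from \<open>y\<close> by at
    most a factor \<open>golden\<close> either way, and its logarithm by at most 1.\<close>
  have "real B \<le> y / golden + y"
    using B_less y by linarith
  also have "\<dots> = y * golden"
  proof -
    have "golden * (golden - 1) = 1"
      using golden_sq by (simp add: algebra_simps power2_eq_square)
    then have "1 / golden = golden - 1"
      using golden_gt_1 by (simp add: divide_eq_eq mult.commute)
    then have "y * (1 / golden) = y * (golden - 1)"
      by (rule arg_cong)
    then show ?thesis
      by (simp add: algebra_simps)
  qed
  finally have "log golden (real B) \<le> log golden (y * golden)"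
    using B_pos golden_gt_1 by simp
  also have "\<dots> = real m * c / 2 + 1"
    using golden_gt_1 y by (simp add: log_mult y_def)
  finally have upper: "log golden (real B) \<le> real m * c / 2 + 1" .
  have "real m * c / 2 - 1 = log golden (y / golden)"
    using golden_gt_1 y by (simp add: log_divide y_def)
  also have "\<dots> \<le> log golden (real B)"
    using B_ge pos golden_gt_1 by simp
  finally have lower: "real m * c / 2 - 1 \<le> log golden (real B)" .
  have "\<bar>2 * log golden (real B) / real m - c\<bar> \<le> 2 / real m"
    using upper lower m by (auto simp: abs_le_iff field_simps)
  then show ?thesis
    using log_in_ammann_chair_dimensions[OF m B_pos B_le] by blast
qed

theorem theorem6p1:
  shows "ammann_chair_dimensions \<subseteq> {0..2} \<and> {0..2} \<subseteq> closure ammann_chair_dimensions"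
proof
  have "0 \<le> d" if "d \<in> ammann_chair_dimensions" for d
    using that unfolding ammann_chair_dimensions_def similarity_dimension_def by blast
  then show "ammann_chair_dimensions \<subseteq> {0..2}"
    using ammann_chair_dimensions_le_2 by auto
next
  show "{0..2} \<subseteq> closure ammann_chair_dimensions"
  proof
    fix c :: real
    assume c: "c \<in> {0..2}"
    show "c \<in> closure ammann_chair_dimensions"
      unfolding closure_approachable
    proof (intro allI impI)
      fix e :: real
      assume "0 < e"
      then obtain k where k: "inverse (real (Suc k)) < e / 2"
        using reals_Archimedean[of "e / 2"] by auto
      obtain d where "d \<in> ammann_chair_dimensions" "\<bar>d - c\<bar> \<le> 2 / real (Suc k)"
        using ammann_chair_dimensions_approx[of "Suc k" c] c by auto
      moreover have "2 / real (Suc k) < e"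
        using k by (simp add: field_simps)
      ultimately show "\<exists>d\<in>ammann_chair_dimensions. dist d c < e"
        unfolding dist_real_def by (meson le_less_trans)
    qed
  qed
qed

end
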